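(* In Model II (described in the context), for every fixed number $j\ge 0$ of low-priority customers, as $n\to\infty$, $$\pi_{1,(n,j)}^{(0)}\sim\beta(0)\,(1-\rho_1-\rho_2)\left(\frac{c_1^{\,j}}{j!}\right)n^j c_0^{\,n-j}.$$
   Context: Model II is the following preemptive priority queue with $N$-policy vacation ($N\ge1$ an integer). High-priority and low-priority customers arrive according to independent Poisson processes with rates $\lambda_1>0$ and $\lambda_2>0$; service times are exponential with rates $\mu_1>0$ and $\mu_2>0$ respectively, all independent. A single server serves each class FCFS, with high-priority customers having preemptive priority over low-priority ones. The server takes a vacation once the system becomes empty, and goes back to work as soon as either the number of low-priority customers reaches $N$ or a high-priority customer arrives; it then works until the system is empty again. Put $\rho_1=\lambda_1/\mu_1$, $\rho_2=\lambda_2/\mu_2$ and assume $\rho_1+\rho_2<1$. For $n\ge1$, $j\ge0$, $\pi_{1,(n,j)}^{(0)}$ is the stationary probability that the server is serving a high-priority customer and there are $n$ high-priority and $j$ low-priority customers in the system. Notation: $\lambda=\lambda_1+\lambda_2$, $r_2=\lambda_2/\lambda$, $H(y)=\sum_{k=0}^{N-1}(r_2y)^k=\frac{(r_2y)^N-1}{r_2y-1}$, $\beta(y)=H(y)/H(1)$, $$c_0=\frac{(\lambda+\mu_1)-\sqrt{(\lambda+\mu_1)^2-4\lambda_1\mu_1}}{2\mu_1},\qquad c_1=\frac{\lambda_2c_0}{\sqrt{(\lambda+\mu_1)^2-4\lambda_1\mu_1}}.$$ The notation $f(n)\sim g(n)$ means $\lim_{n\to\infty}f(n)/g(n)=1$.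 *)

theory Defs
  imports "HOL-Probability.Probability"
begin

section \<open>Continuous-time Markov chains on a countable state set\<close>

text \<open>
  \<open>ctmc S Q P\<close>: the kernels \<open>P t x\<close> (law at time \<open>t\<close> of the chain started in \<open>x\<close>) form a
  stochastic semigroup on \<open>S\<close> with infinitesimal transition rates (Q-matrix) \<open>Q\<close>.
  Values of \<open>P\<close> outside \<open>S\<close> or at negative times are irrelevant.  For uniformly bounded rates,
  as below, \<open>Q\<close> determines \<open>P\<close> on \<open>S\<close> and nonnegative times.
\<close>
definition ctmc :: "'s set \<Rightarrow> ('s \<Rightarrow> 's \<Rightarrow> real) \<Rightarrow> (real \<Rightarrow> 's \<Rightarrow> 's pmf) \<Rightarrow> bool" where
  "ctmc S Q P \<longleftrightarrow>
     (\<forall>x\<in>S. \<forall>t\<ge>0. set_pmf (P t x) \<subseteq> S) \<and>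
     (\<forall>x\<in>S. P 0 x = return_pmf x) \<and>
     (\<forall>x\<in>S. \<forall>s\<ge>0. \<forall>t\<ge>0. P (s + t) x = bind_pmf (P s x) (P t)) \<and>
     (\<forall>x\<in>S. \<forall>y\<in>S. ((\<lambda>t. pmf (P t x) y) has_real_derivative Q x y) (at_right 0))"

definition stationary_distribution ::
    "'s set \<Rightarrow> (real \<Rightarrow> 's \<Rightarrow> 's pmf) \<Rightarrow> 's pmf \<Rightarrow> bool" where
  "stationary_distribution S P p \<longleftrightarrow> set_pmf p \<subseteq> S \<and> (\<forall>t\<ge>0. bind_pmf p (P t) = p)"

section \<open>The preemptive priority queue with N-policy vacation\<close>

text \<open>
  \<open>Vacation j\<close>: the server is on vacation and \<open>j\<close> low-priority customers are waiting (a
  high-priority arrival ends the vacation, so no high-priority customer can be present).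
  \<open>Working n j\<close>: the server works, with \<open>n\<close> high-priority and \<open>j\<close> low-priority customers in the
  system; by preemption a high-priority customer is in service iff \<open>n \<ge> 1\<close>.
\<close>
datatype state = Vacation nat | Working nat nat

definition states :: "nat \<Rightarrow> state set" where
  "states N = {Vacation j |j. j < N} \<union> {Working n j |n j. n + j \<ge> 1}"

fun high_arrival :: "state \<Rightarrow> state" where
  "high_arrival (Vacation j) = Working 1 j"
| "high_arrival (Working n j) = Working (n + 1) j"

fun low_arrival :: "nat \<Rightarrow> state \<Rightarrow> state" where
  "low_arrival N (Vacation j) = (if j + 1 < N then Vacation (j + 1) else Working 0 (j + 1))"
| "low_arrival N (Working n j) = Working n (j + 1)"

text \<open>The \<open>Vacation\<close> clause is a dummy: the service rate is 0 there.\<close>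
fun departure :: "state \<Rightarrow> state" where
  "departure (Vacation j) = Vacation j"
| "departure (Working n j) =
     (if n + j = 1 then Vacation 0
      else if n \<ge> 1 then Working (n - 1) j
      else Working 0 (j - 1))"

fun service_rate :: "real \<Rightarrow> real \<Rightarrow> state \<Rightarrow> real" where
  "service_rate mu1 mu2 (Vacation j) = 0"
| "service_rate mu1 mu2 (Working n j) = (if n \<ge> 1 then mu1 else mu2)"

text \<open>
  An event moving the chain from \<open>x\<close> to \<open>x'\<close> at rate \<open>r\<close> contributes \<open>r\<close> to the entry \<open>(x, x')\<close>
  and \<open>- r\<close> to the diagonal entry \<open>(x, x)\<close>.
\<close>
definition rate_matrix ::
    "real \<Rightarrow> real \<Rightarrow> real \<Rightarrow> real \<Rightarrow> nat \<Rightarrow> state \<Rightarrow> state \<Rightarrow> real" where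
  "rate_matrix lam1 lam2 mu1 mu2 N x y =
     lam1 * (of_bool (y = high_arrival x) - of_bool (y = x)) +
     lam2 * (of_bool (y = low_arrival N x) - of_bool (y = x)) +
     service_rate mu1 mu2 x * (of_bool (y = departure x) - of_bool (y = x))"

section \<open>Constants of the asymptotic formula\<close>

definition H :: "real \<Rightarrow> real \<Rightarrow> nat \<Rightarrow> real \<Rightarrow> real" where
  "H lam1 lam2 N y = (\<Sum>k<N. ((lam2 / (lam1 + lam2)) * y) ^ k)"

definition \<beta> :: "real \<Rightarrow> real \<Rightarrow> nat \<Rightarrow> real \<Rightarrow> real" where
  "\<beta> lam1 lam2 N y = H lam1 lam2 N y / H lam1 lam2 N 1"

definition c0 :: "real \<Rightarrow> real \<Rightarrow> real \<Rightarrow> real" where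
  "c0 lam1 lam2 mu1 =
     ((lam1 + lam2 + mu1) - sqrt ((lam1 + lam2 + mu1)\<^sup>2 - 4 * lam1 * mu1)) / (2 * mu1)"

definition c1 :: "real \<Rightarrow> real \<Rightarrow> real \<Rightarrow> real" where
  "c1 lam1 lam2 mu1 =
     lam2 * c0 lam1 lam2 mu1 / sqrt ((lam1 + lam2 + mu1)\<^sup>2 - 4 * lam1 * mu1)"

end

theory Submission imports Defs "HOL-Real_Asymp.Real_Asymp" begin

text \<open>
  In the stationary regime, the probabilities with \<open>j\<close> low-priority and \<open>n\<close> high-priority customers
  satisfy, for each \<open>j\<close>, a linear second-order recurrence in \<open>n\<close> (\<open>level_balance\<close>) whose source term is
  \<open>lam2\<close> times the solution for \<open>j - 1\<close>.  One characteristic root is \<open>c0\<close>, in the open unit interval, and the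
  other one exceeds 1.  Since probabilities are bounded, the larger root cannot contribute.  For
  \<open>j = 0\<close> there is no source, so the solution is a multiple of \<open>c0 ^ n\<close>.  For larger \<open>j\<close> the source has the
  exponential rate \<open>c0\<close> of the homogeneous solution; this resonance raises the power of \<open>n\<close>
  by one in every step and divides the constant by \<open>j\<close>, whence the factor \<open>n ^ j / j!\<close>
  (\<open>level_asymptotics\<close>).  The recurrence is solved asymptotically by factoring it into two first-order
  recurrences, to each of which one form of the Stolz-Cesaro theorem applies.

  The only unknown left is the value at \<open>n = j = 0\<close>, the probability of the empty system.  On vacation
  the number of waiting customers follows a truncated geometric law with ratio
  \<open>lam2 / (lam1 + lam2)\<close>, and the server is on vacation with probability \<open>1 - lam1 / mu1 - lam2 / mu2\<close>: by flow
  balance across the level sets of either customer count, each class occupies the server for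
  a fraction of time equal to its load.  Hence the empty system has probability
  \<open>\<beta> 0 * (1 - lam1 / mu1 - lam2 / mu2)\<close> (\<open>vacation_0\<close>).

  All balance equations are instances of \<open>flow_balance\<close>, which comes from differentiating stationarity
  at time 0 under the expectation.  The interchange is justified by dominated convergence: the total
  rates are bounded, and \<open>ctmc_holding_probability\<close> turns this into a bound on difference quotients.
\<close>

section \<open>Asymptotics of linear recurrences\<close>

lemma telescoping_bound:
  fixes z y :: "nat \<Rightarrow> real"
  assumes "\<And>k. m \<le> k \<Longrightarrow> \<bar>z (Suc k) - z k\<bar> \<le> y (Suc k) - y k" and "m \<le> n"
  shows "\<bar>z n - z m\<bar> \<le> y n - y m"
  using assms(2)
proof (induction n rule: dec_induct)
  case (step n)
  then show ?case using assms(1)[of n] by linarith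
qed simp

text \<open>
  The common core of both forms of the Stolz-Cesaro theorem: up to a small multiple of the increment
  of \<open>y\<close>, the sequence \<open>x - L * y\<close> stands still.  Telescoping then runs from a fixed index upwards if \<open>y\<close>
  grows without bound, and from \<open>n\<close> to infinity if \<open>x\<close> and \<open>y\<close> both vanish in the limit.
\<close>
lemma increments_near_limit:
  fixes x y :: "nat \<Rightarrow> real"
  assumes "eventually (\<lambda>n. y (Suc n) \<noteq> y n) sequentially"
    and "(\<lambda>n. (x (Suc n) - x n) / (y (Suc n) - y n)) \<longlonglongrightarrow> L" and "e > 0"
  shows "eventually (\<lambda>n. \<bar>(x (Suc n) - L * y (Suc n)) - (x n - L * y n)\<bar>
            \<le> e * \<bar>y (Suc n) - y n\<bar>) sequentially"
  using assms(1) tendstoD[OF assms(2,3)]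
proof eventually_elim
  case (elim n)
  define D where "D = y (Suc n) - y n"
  have D: "D \<noteq> 0" using elim by (simp add: D_def)
  have "(x (Suc n) - L * y (Suc n)) - (x n - L * y n) = (x (Suc n) - x n) - L * D"
    by (simp add: D_def algebra_simps)
  also have "\<dots> = ((x (Suc n) - x n) / D - L) * D"
    using D by (simp add: field_simps)
  finally have "(x (Suc n) - L * y (Suc n)) - (x n - L * y n) = ((x (Suc n) - x n) / D - L) * D" .
  moreover have "\<bar>(x (Suc n) - x n) / D - L\<bar> \<le> e"
    using elim by (simp add: dist_real_def D_def)
  ultimately show ?case
    by (simp add: abs_mult D_def[symmetric] mult_right_mono)
qed

lemma stolz_cesaro_at_top:
  fixes x y :: "nat \<Rightarrow> real"
  assumes inc: "eventually (\<lambda>n. y n < y (Suc n)) sequentially"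
    and y: "filterlim y at_top sequentially"
    and lim: "(\<lambda>n. (x (Suc n) - x n) / (y (Suc n) - y n)) \<longlonglongrightarrow> L"
  shows "(\<lambda>n. x n / y n) \<longlonglongrightarrow> L"
proof (rule tendstoI)
  fix e :: real assume e: "e > 0"
  define z where "z n = x n - L * y n" for n
  have "eventually (\<lambda>n. \<bar>z (Suc n) - z n\<bar> \<le> e / 2 * \<bar>y (Suc n) - y n\<bar>) sequentially"
    unfolding z_def
    by (rule increments_near_limit[OF eventually_mono[OF inc] lim]) (use e in auto)
  with inc have "eventually (\<lambda>n. \<bar>z (Suc n) - z n\<bar> \<le> e / 2 * y (Suc n) - e / 2 * y n) sequentially"
    by eventually_elim (auto simp: algebra_simps)
  then obtain m where m: "\<And>k. m \<le> k \<Longrightarrow> \<bar>z (Suc k) - z k\<bar> \<le> e / 2 * y (Suc k) - e / 2 * y k"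
    by (auto simp: eventually_sequentially)
  have "eventually (\<lambda>n. y n > max 0 (2 / e * (\<bar>z m\<bar> - e / 2 * y m))) sequentially"
    using y unfolding filterlim_at_top_dense by blast
  then show "eventually (\<lambda>n. dist (x n / y n) L < e) sequentially"
    using eventually_ge_at_top[of m]
  proof eventually_elim
    case (elim n)
    have "\<bar>z n - z m\<bar> \<le> e / 2 * y n - e / 2 * y m"
      by (rule telescoping_bound[of m z "\<lambda>k. e / 2 * y k"]) (use m elim in auto)
    moreover have "\<bar>z m\<bar> - e / 2 * y m < e / 2 * y n"
      using elim e by (simp add: field_simps)
    ultimately have "\<bar>z n\<bar> < e * y n" by linarith
    moreover have "x n / y n - L = z n / y n" using elim by (simp add: z_def field_simps)
    ultimately show ?case using elim by (simp add: dist_real_def field_simps)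
  qed
qed

lemma stolz_cesaro_null:
  fixes x y :: "nat \<Rightarrow> real"
  assumes dec: "eventually (\<lambda>n. y (Suc n) < y n) sequentially"
    and y: "y \<longlonglongrightarrow> 0" and x: "x \<longlonglongrightarrow> 0"
    and lim: "(\<lambda>n. (x (Suc n) - x n) / (y (Suc n) - y n)) \<longlonglongrightarrow> L"
  shows "(\<lambda>n. x n / y n) \<longlonglongrightarrow> L"
proof (rule tendstoI)
  fix e :: real assume e: "e > 0"
  define z where "z n = x n - L * y n" for n
  have z: "z \<longlonglongrightarrow> 0" unfolding z_def using tendsto_diff[OF x tendsto_mult[OF tendsto_const y]] by simp
  have "eventually (\<lambda>n. \<bar>z (Suc n) - z n\<bar> \<le> e / 2 * \<bar>y (Suc n) - y n\<bar>) sequentially"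
    unfolding z_def
    by (rule increments_near_limit[OF eventually_mono[OF dec] lim]) (use e in auto)
  with dec have "eventually (\<lambda>n. y (Suc n) < y n \<and>
      \<bar>z (Suc n) - z n\<bar> \<le> - (e / 2) * y (Suc n) - - (e / 2) * y n) sequentially"
    by eventually_elim (auto simp: algebra_simps)
  then obtain m where dec_m: "\<And>k. m \<le> k \<Longrightarrow> y (Suc k) < y k"
    and m: "\<And>k. m \<le> k \<Longrightarrow> \<bar>z (Suc k) - z k\<bar> \<le> - (e / 2) * y (Suc k) - - (e / 2) * y k"
    unfolding eventually_sequentially by blast
  have bound: "\<bar>z n\<bar> \<le> e / 2 * y n" if "m \<le> n" for n
  proof -
    have "eventually (\<lambda>k. \<bar>z k - z n\<bar> \<le> - (e / 2) * y k - - (e / 2) * y n) sequentially"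
      using eventually_ge_at_top[of n]
      by eventually_elim
        (rule telescoping_bound[of n z "\<lambda>k. - (e / 2) * y k"], use m that in auto)
    moreover have "(\<lambda>k. \<bar>z k - z n\<bar>) \<longlonglongrightarrow> \<bar>0 - z n\<bar>"
      by (intro tendsto_intros z)
    moreover have "(\<lambda>k. - (e / 2) * y k - - (e / 2) * y n) \<longlonglongrightarrow> - (e / 2) * 0 - - (e / 2) * y n"
      by (intro tendsto_intros y)
    ultimately have "\<bar>0 - z n\<bar> \<le> - (e / 2) * 0 - - (e / 2) * y n"
      by (intro tendsto_le[OF sequentially_bot]) auto
    then show ?thesis by simp
  qed
  have pos: "y n > 0" if "m \<le> n" for n
  proof -
    have "0 \<le> e / 2 * y (Suc n)" using bound[of "Suc n"] that by linarith
    then show ?thesis using e dec_m[of n] that by (auto simp: zero_le_mult_iff)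
  qed
  show "eventually (\<lambda>n. dist (x n / y n) L < e) sequentially"
    using eventually_ge_at_top[of m]
  proof eventually_elim
    case (elim n)
    have "x n / y n - L = z n / y n" using pos[OF elim] by (simp add: z_def field_simps)
    moreover have "\<bar>z n\<bar> < e * y n"
      using bound[OF elim] mult_pos_pos[OF e pos[OF elim]] by simp
    ultimately show ?case using pos[OF elim] by (simp add: dist_real_def field_simps)
  qed
qed

lemma Suc_ratio_power_tendsto: "(\<lambda>n. (real (Suc n) / real n) ^ m) \<longlonglongrightarrow> 1"
proof -
  have "(\<lambda>n. real (Suc n) / real n) \<longlonglongrightarrow> 1"
    using LIMSEQ_Suc_n_over_n[where 'a=real] by simp
  from tendsto_power[OF this, of m] show ?thesis by simp
qed

text \<open>
  With \<open>h = 1 / n\<close> this is the difference quotient of \<open>t ^ Suc m\<close> at \<open>t = 1\<close>.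
\<close>
lemma power_increment_asymptotics:
  "(\<lambda>n. (real (Suc n) ^ Suc m - real n ^ Suc m) / real n ^ m) \<longlonglongrightarrow> real (Suc m)"
proof -
  have "((\<lambda>t. t ^ Suc m) has_real_derivative real (Suc m) * 1 ^ m) (at (1::real))"
    by (rule derivative_eq_intros refl | simp)+
  then have "((\<lambda>h. ((1 + h) ^ Suc m - 1 ^ Suc m) / h) \<longlongrightarrow> real (Suc m)) (at (0::real))"
    by (simp add: DERIV_def)
  moreover have "filterlim (\<lambda>n. inverse (real n)) (at 0) sequentially"
  proof (rule filterlim_atI)
    show "eventually (\<lambda>n. inverse (real n) \<noteq> 0) sequentially"
      using eventually_gt_at_top[of 0] by eventually_elim simp
  qed (rule lim_inverse_n)
  ultimately have "(\<lambda>n. ((1 + inverse (real n)) ^ Suc m - 1 ^ Suc m) / inverse (real n))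
      \<longlonglongrightarrow> real (Suc m)"
    by (rule filterlim_compose)
  moreover have "eventually (\<lambda>n. ((1 + inverse (real n)) ^ Suc m - 1 ^ Suc m) / inverse (real n)
      = (real (Suc n) ^ Suc m - real n ^ Suc m) / real n ^ m) sequentially"
    using eventually_gt_at_top[of 0]
  proof eventually_elim
    case (elim n)
    have *: "1 + inverse (real n) = real (Suc n) / real n" using elim by (simp add: field_simps)
    show ?case unfolding * using elim by (simp add: power_divide field_simps del: of_nat_Suc)
  qed
  ultimately show ?thesis by (rule Lim_transform_eventually)
qed

text \<open>
  The general solution of the homogeneous equation grows like \<open>w ^ n\<close>, so boundedness singles out one
  solution, and it follows the inhomogeneity.  To see its size, divide by \<open>w ^ n\<close>: the quotient
  tends to 0 and its increments are \<open>- c * b (Suc n) / w ^ Suc n\<close>.  Comparing with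
  \<open>n ^ m * (z / w) ^ n\<close> by Stolz-Cesaro in the null form gives the limit.
\<close>
lemma growing_recurrence_bounded_solution:
  fixes b d :: "nat \<Rightarrow> real"
  assumes rec: "\<And>n. d (Suc n) = w * d n - c * b (Suc n)"
    and bdd: "Bseq d" and z: "0 < z" "z < w" and w: "1 < w"
    and b: "(\<lambda>n. b n / (real n ^ m * z ^ n)) \<longlonglongrightarrow> B"
  shows "(\<lambda>n. d n / (real n ^ m * z ^ n)) \<longlonglongrightarrow> c * B * z / (w - z)"
proof -
  define q where "q = z / w"
  have q: "0 < q" "q < 1" using z w by (auto simp: q_def)
  define x where "x n = d n * (1 / w) ^ n" for n
  define y where "y n = real n ^ m * q ^ n" for n
  have ratio: "(\<lambda>n. q * (real (Suc n) / real n) ^ m - 1) \<longlonglongrightarrow> q * 1 - 1"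
    by (intro tendsto_intros Suc_ratio_power_tendsto)
  have y_diff: "y (Suc n) - y n = real n ^ m * q ^ n * (q * (real (Suc n) / real n) ^ m - 1)"
    if "n > 0" for n
    using that by (simp add: y_def power_divide field_simps del: of_nat_Suc)
  have x_diff: "x (Suc n) - x n = - c * b (Suc n) / w ^ Suc n" for n
    using w by (simp add: x_def rec field_simps power_divide)
  have neg: "eventually (\<lambda>n. q * (real (Suc n) / real n) ^ m - 1 < 0) sequentially"
    using order_tendstoD(2)[OF ratio, of 0] q by simp
  have "(\<lambda>n. x n / y n) \<longlonglongrightarrow> c * B * z / (w - z)"
  proof (rule stolz_cesaro_null)
    show "eventually (\<lambda>n. y (Suc n) < y n) sequentially"
      using neg eventually_gt_at_top[of 0]
    proof eventually_elim
      case (elim n)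
      have "real n ^ m * q ^ n * (q * (real (Suc n) / real n) ^ m - 1) < 0"
        using elim q by (intro mult_pos_neg) auto
      then show ?case using y_diff[OF elim(2)] by simp
    qed
    show "y \<longlonglongrightarrow> 0" unfolding y_def
      using q by real_asymp
    \<comment> \<open>Boundedness of \<open>d\<close> excludes a component of order \<open>w ^ n\<close>.\<close>
    have "(\<lambda>n. (1 / w) ^ n) \<longlonglongrightarrow> 0"
      using w by (intro LIMSEQ_power_zero) auto
    then have "Zfun (\<lambda>n. (1 / w) ^ n * d n) sequentially"
      using bdd by (intro bounded_bilinear.Zfun_prod_Bfun[OF bounded_bilinear_mult]) (auto simp: tendsto_Zfun_iff)
    then show "x \<longlonglongrightarrow> 0" by (simp add: tendsto_Zfun_iff x_def[abs_def] mult.commute)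
    have "(\<lambda>n. - (c / w) * z * (b (Suc n) / (real (Suc n) ^ m * z ^ Suc n))
             * (real (Suc n) / real n) ^ m / (q * (real (Suc n) / real n) ^ m - 1))
          \<longlonglongrightarrow> - (c / w) * z * B * 1 / (q * 1 - 1)"
      by (intro tendsto_intros ratio LIMSEQ_Suc[OF b] Suc_ratio_power_tendsto) (use q in auto)
    moreover have "- (c / w) * z * B * 1 / (q * 1 - 1) = c * B * z / (w - z)"
      using z w by (simp add: q_def field_simps)
    moreover have "eventually (\<lambda>n. - (c / w) * z * (b (Suc n) / (real (Suc n) ^ m * z ^ Suc n))
             * (real (Suc n) / real n) ^ m / (q * (real (Suc n) / real n) ^ m - 1)
         = (x (Suc n) - x n) / (y (Suc n) - y n)) sequentially"
      using neg eventually_gt_at_top[of 0]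
    proof eventually_elim
      case (elim n)
      define R where "R = q * (real (Suc n) / real n) ^ m - 1"
      have "R \<noteq> 0" using elim by (simp add: R_def)
      then have "- (c / w) * z * (b (Suc n) / (real (Suc n) ^ m * z ^ Suc n))
             * (real (Suc n) / real n) ^ m / R
         = - c * b (Suc n) / w ^ Suc n / (real n ^ m * q ^ n * R)"
        using elim z w by (simp add: q_def power_divide divide_simps del: of_nat_Suc)
      then show ?case unfolding y_diff[OF elim(2)] x_diff R_def .
    qed
    ultimately show "(\<lambda>n. (x (Suc n) - x n) / (y (Suc n) - y n)) \<longlonglongrightarrow> c * B * z / (w - z)"
      by (auto intro: Lim_transform_eventually)
  qed
  moreover have "x n / y n = d n / (real n ^ m * z ^ n)" for n
    using w by (simp add: x_def y_def q_def power_divide)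
  ultimately show ?thesis by simp
qed

text \<open>
  The inhomogeneity has the same exponential rate \<open>z\<close> as the homogeneous solution, so \<open>a n / z ^ n\<close> has
  increments of order \<open>n ^ m\<close> and gains one power of \<open>n\<close>; the factor \<open>Suc m\<close> comes from summing \<open>n ^ m\<close>.
\<close>
lemma resonant_recurrence_asymptotics:
  fixes a d :: "nat \<Rightarrow> real"
  assumes rec: "\<And>n. a (Suc n) = z * a n + d n" and z: "0 < z"
    and d: "(\<lambda>n. d n / (real n ^ m * z ^ n)) \<longlonglongrightarrow> D"
  shows "(\<lambda>n. a n / (real n ^ Suc m * z ^ n)) \<longlonglongrightarrow> D / (z * real (Suc m))"
proof -
  define x where "x n = a n / z ^ n" for n
  define y where "y n = real n ^ Suc m" for n :: nat
  have "(\<lambda>n. x n / y n) \<longlonglongrightarrow> D / (z * real (Suc m))"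
  proof (rule stolz_cesaro_at_top)
    show "eventually (\<lambda>n. y n < y (Suc n)) sequentially"
      unfolding y_def by (intro always_eventually allI power_strict_mono) auto
    show "filterlim y at_top sequentially"
      unfolding y_def by (rule filterlim_pow_at_top[OF _ filterlim_real_sequentially]) simp
    have "(\<lambda>n. 1 / z * (d n / (real n ^ m * z ^ n))
            / ((real (Suc n) ^ Suc m - real n ^ Suc m) / real n ^ m)) \<longlonglongrightarrow> 1 / z * D / real (Suc m)"
      by (intro tendsto_intros d power_increment_asymptotics) simp
    moreover have "eventually (\<lambda>n. 1 / z * (d n / (real n ^ m * z ^ n))
            / ((real (Suc n) ^ Suc m - real n ^ Suc m) / real n ^ m)
          = (x (Suc n) - x n) / (y (Suc n) - y n)) sequentially"
      using eventually_gt_at_top[of 0]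
    proof eventually_elim
      case (elim n)
      have "x (Suc n) - x n = d n / z ^ Suc n"
        using z by (simp add: x_def rec field_simps)
      then show ?case using elim z by (simp add: y_def del: of_nat_Suc power_Suc) (simp add: field_simps)
    qed
    ultimately show "(\<lambda>n. (x (Suc n) - x n) / (y (Suc n) - y n)) \<longlonglongrightarrow> D / (z * real (Suc m))"
      by (simp add: Lim_transform_eventually)
  qed
  then show ?thesis by (simp add: x_def y_def mult.commute)
qed

section \<open>Flow balance for stationary Markov chains\<close>

lemma ctmc_0: "ctmc S Q P \<Longrightarrow> x \<in> S \<Longrightarrow> P 0 x = return_pmf x"
  and ctmc_add: "ctmc S Q P \<Longrightarrow> x \<in> S \<Longrightarrow> s \<ge> 0 \<Longrightarrow> t \<ge> 0 \<Longrightarrow> P (s + t) x = bind_pmf (P s x) (P t)"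
  and ctmc_deriv: "ctmc S Q P \<Longrightarrow> x \<in> S \<Longrightarrow> y \<in> S \<Longrightarrow>
    ((\<lambda>t. pmf (P t x) y) has_real_derivative Q x y) (at_right 0)"
  by (auto simp: ctmc_def)

lemma measure_bind_pmf:
  "measure (measure_pmf (bind_pmf p f)) A = (\<integral>x. measure (measure_pmf (f x)) A \<partial>measure_pmf p)"
proof -
  have "ennreal (measure (measure_pmf (bind_pmf p f)) A)
      = (\<integral>\<^sup>+x. ennreal (measure (measure_pmf (f x)) A) \<partial>measure_pmf p)"
    by (simp add: measure_pmf.emeasure_eq_measure[symmetric])
  also have "\<dots> = ennreal (\<integral>x. measure (measure_pmf (f x)) A \<partial>measure_pmf p)"
    by (intro nn_integral_eq_integral measure_pmf.integrable_const_bound[where B=1]) auto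
  finally show ?thesis by (simp add: integral_nonneg_AE)
qed

text \<open>
  Times along which derivatives at 0 are taken: pieces of \<open>[0, t]\<close> for the bound on return
  probabilities, and a sequence to which dominated convergence applies for stationarity.
\<close>
lemma filterlim_inverse_scaled:
  assumes "t > (0::real)"
  shows "filterlim (\<lambda>n. t / real (Suc n)) (at_right 0) sequentially"
proof (rule tendsto_imp_filterlim_at_right)
  show "(\<lambda>n. t / real (Suc n)) \<longlonglongrightarrow> 0"
    using LIMSEQ_Suc[OF lim_const_over_n[of t]] by simp
qed (use assms in auto)

lemma ctmc_difference_quotient:
  assumes "ctmc S Q P" "x \<in> S" "y \<in> S"
  shows "((\<lambda>t. (pmf (P t x) y - of_bool (x = y)) / t) \<longlongrightarrow> Q x y) (at_right 0)"
  using ctmc_deriv[OF assms] ctmc_0[OF assms(1,2)]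
  by (auto simp: has_field_derivative_iff indicator_def split: if_splits)

text \<open>
  The return probability is supermultiplicative, \<open>P (s + r) x x \<ge> P s x x * P r x x\<close>, because returning at
  time \<open>s\<close> and again after a further time \<open>r\<close> is one way of being in \<open>x\<close> at time \<open>s + r\<close>.  Cutting
  \<open>[0, t]\<close> into \<open>n\<close> pieces and applying Bernoulli's inequality gives
  \<open>1 - P t x x \<le> n * (1 - P (t / n) x x)\<close>, and the right-hand side tends to \<open>- Q x x * t\<close>.  With bounded
  rates this dominates all difference quotients of the semigroup uniformly in \<open>x\<close> and \<open>t\<close>.
\<close>
lemma ctmc_holding_probability:
  assumes C: "ctmc S Q P" and x: "x \<in> S" and t: "t > 0"
  shows "1 - pmf (P t x) x \<le> - Q x x * t"
proof -
  have super: "pmf (P s x) x * pmf (P r x) x \<le> pmf (P (s + r) x) x" if "s \<ge> 0" "r \<ge> 0" for s r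
  proof -
    have "pmf (P s x) x * pmf (P r x) x
        = (\<integral>z. indicator {x} z * pmf (P r x) x \<partial>measure_pmf (P s x))"
      by (simp add: measure_pmf_single)
    also have "\<dots> \<le> (\<integral>z. pmf (P r z) x \<partial>measure_pmf (P s x))"
      by (intro integral_mono measure_pmf.integrable_const_bound[where B=1])
        (auto simp: pmf_le_1 indicator_def)
    also have "\<dots> = pmf (P (s + r) x) x"
      by (simp add: ctmc_add[OF C x that] pmf_bind)
    finally show ?thesis .
  qed
  have pow: "pmf (P s x) x ^ n \<le> pmf (P (real n * s) x) x" if "s \<ge> 0" for n s
  proof (induction n)
    case 0
    then show ?case by (simp add: ctmc_0[OF C x])
  next
    case (Suc n)
    have "pmf (P s x) x ^ Suc n \<le> pmf (P s x) x * pmf (P (real n * s) x) x"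
      using Suc by (simp add: mult_left_mono)
    also have "\<dots> \<le> pmf (P (s + real n * s) x) x" by (rule super) (use that in auto)
    finally show ?case by (simp add: algebra_simps)
  qed
  have bound: "1 - pmf (P t x) x \<le> real (Suc n) * (1 - pmf (P (t / real (Suc n)) x) x)" for n
  proof -
    define f where "f = pmf (P (t / real (Suc n)) x) x"
    have "1 + real (Suc n) * (f - 1) \<le> (1 + (f - 1)) ^ Suc n"
      by (rule Bernoulli_inequality) (simp add: f_def)
    also have "\<dots> \<le> pmf (P t x) x"
      using pow[of "t / real (Suc n)" "Suc n"] t by (simp add: f_def del: of_nat_Suc power_Suc)
    finally show ?thesis unfolding f_def[symmetric] by (simp add: algebra_simps)
  qed
  have "(\<lambda>n. - t * ((pmf (P (t / real (Suc n)) x) x - of_bool (x = x)) / (t / real (Suc n))))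
      \<longlonglongrightarrow> - t * Q x x"
    by (intro tendsto_intros
        filterlim_compose[OF ctmc_difference_quotient[OF C x x] filterlim_inverse_scaled[OF t]])
  moreover have "- t * ((pmf (P (t / real (Suc n)) x) x - of_bool (x = x)) / (t / real (Suc n)))
      = real (Suc n) * (1 - pmf (P (t / real (Suc n)) x) x)" for n
    using t by (simp add: field_simps)
  ultimately have "(\<lambda>n. real (Suc n) * (1 - pmf (P (t / real (Suc n)) x) x)) \<longlonglongrightarrow> - t * Q x x"
    by simp
  then show ?thesis using bound by (auto intro: LIMSEQ_le_const simp: mult.commute)
qed

lemma measure_pmf_indicator_diff_le:
  "\<bar>measure (measure_pmf q) A - indicator A x\<bar> \<le> 1 - pmf q x"
proof (cases "x \<in> A")
  case True
  then have "pmf q x \<le> measure (measure_pmf q) A"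
    unfolding measure_pmf_single[symmetric] by (intro measure_pmf.finite_measure_mono) auto
  then show ?thesis using True by (auto simp: indicator_def)
next
  case False
  then have "measure (measure_pmf q) ({x} \<union> A) = pmf q x + measure (measure_pmf q) A"
    by (subst measure_pmf.finite_measure_Union) (auto simp: measure_pmf_single)
  then show ?thesis using False measure_pmf.prob_le_1[of q "{x} \<union> A"] by (auto simp: indicator_def)
qed

text \<open>
  The derivative of \<open>P t x A\<close> for an arbitrary, possibly infinite set \<open>A\<close>.  Inside \<open>F\<close> the sum is finite.
  As the rates towards \<open>F\<close> already sum to 0, the mass lost by \<open>F\<close> has derivative 0, hence so has the
  mass \<open>P t x (A - F)\<close>, which is at most that lost mass.
\<close>
lemma ctmc_set_difference_quotient:
  assumes C: "ctmc S Q P" and x: "x \<in> F" and F: "finite F" "F \<subseteq> S" and "(\<Sum>y\<in>F. Q x y) = 0"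
  shows "((\<lambda>t. (measure (measure_pmf (P t x)) A - indicator A x) / t) \<longlongrightarrow> (\<Sum>y\<in>F \<inter> A. Q x y)) (at_right 0)"
proof -
  define g where "g t G = (measure (measure_pmf (P t x)) G - indicator G x) / t" for t G
  have fin: "((\<lambda>t. g t G) \<longlongrightarrow> (\<Sum>y\<in>G. Q x y)) (at_right 0)" if "G \<subseteq> F" for G
  proof -
    have G: "finite G" using that F finite_subset by blast
    have "((\<lambda>t. \<Sum>y\<in>G. (pmf (P t x) y - of_bool (x = y)) / t) \<longlongrightarrow> (\<Sum>y\<in>G. Q x y)) (at_right 0)"
      by (intro tendsto_sum ctmc_difference_quotient[OF C]) (use x F that in auto)
    moreover have "(\<Sum>y\<in>G. (pmf (P t x) y - of_bool (x = y)) / t) = g t G" for t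
      using G by (simp add: g_def measure_measure_pmf_finite indicator_def of_bool_def
          sum_divide_distrib[symmetric] sum_subtractf)
    ultimately show ?thesis by simp
  qed
  have split: "g t A = g t (F \<inter> A) + g t (A - F)" for t
  proof -
    have "measure (measure_pmf (P t x)) A
        = measure (measure_pmf (P t x)) (F \<inter> A) + measure (measure_pmf (P t x)) (A - F)"
      by (subst measure_pmf.finite_measure_Union[symmetric]) (auto intro: arg_cong[where f="measure _"])
    then show ?thesis using x by (auto simp: g_def add_divide_distrib diff_divide_distrib indicator_def)
  qed
  \<comment> \<open>\<open>x\<close> lies in \<open>F\<close>, so \<open>- g t F\<close> is the mass outside \<open>F\<close> divided by \<open>t\<close>.\<close>
  have "((\<lambda>t. g t (A - F)) \<longlongrightarrow> 0) (at_right 0)"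
  proof (rule tendsto_sandwich[where f="\<lambda>_. 0" and h="\<lambda>t. - g t F"])
    have "((\<lambda>t. - g t F) \<longlongrightarrow> - (\<Sum>y\<in>F. Q x y)) (at_right 0)" by (intro tendsto_minus fin) simp
    then show "((\<lambda>t. - g t F) \<longlongrightarrow> 0) (at_right 0)" using assms(5) by simp
    have "0 \<le> g t (A - F) \<and> g t (A - F) \<le> - g t F" if "t > 0" for t
    proof -
      have "measure (measure_pmf (P t x)) (A - F) + measure (measure_pmf (P t x)) F \<le> 1"
        by (subst measure_pmf.finite_measure_Union[symmetric]) auto
      then show ?thesis using x that by (auto simp: g_def field_simps)
    qed
    then show "eventually (\<lambda>t. 0 \<le> g t (A - F)) (at_right 0)"
      "eventually (\<lambda>t. g t (A - F) \<le> - g t F) (at_right 0)"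
      using eventually_at_right_less[of "0::real"] by (auto elim!: eventually_mono)
  qed auto
  then have "((\<lambda>t. g t (F \<inter> A) + g t (A - F)) \<longlongrightarrow> (\<Sum>y\<in>F \<inter> A. Q x y) + 0) (at_right 0)"
    by (intro tendsto_add fin) auto
  then show ?thesis by (simp add: split[symmetric]) (simp add: g_def)
qed

text \<open>
  Under stationarity the expected change of \<open>indicator A\<close> over any time is 0; divide by the time and let
  it tend to 0.  Having this for sets rather than single states gives the cut equations below
  without summing infinitely many balance equations.
\<close>
lemma stationary_flow_balance:
  assumes C: "ctmc S Q P" and st: "stationary_distribution S P p"
    and F: "\<And>x. x \<in> S \<Longrightarrow> x \<in> F x \<and> finite (F x) \<and> F x \<subseteq> S \<and> (\<Sum>y\<in>F x. Q x y) = 0"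
    and q: "\<And>x. x \<in> S \<Longrightarrow> - Q x x \<le> q"
  shows "measure_pmf.expectation p (\<lambda>x. \<Sum>y\<in>F x \<inter> A. Q x y) = 0"
proof -
  have S: "AE x in measure_pmf p. x \<in> S"
    using st by (auto simp: AE_measure_pmf_iff stationary_distribution_def)
  define g where "g n x = (measure (measure_pmf (P (1 / real (Suc n)) x)) A - indicator A x)
      / (1 / real (Suc n))" for n x
  have "(\<lambda>n. measure_pmf.expectation p (g n)) \<longlonglongrightarrow> measure_pmf.expectation p (\<lambda>x. \<Sum>y\<in>F x \<inter> A. Q x y)"
  proof (rule integral_dominated_convergence[where w="\<lambda>_. q"])
    show "AE x in measure_pmf p. (\<lambda>n. g n x) \<longlonglongrightarrow> (\<Sum>y\<in>F x \<inter> A. Q x y)"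
      using S
    proof eventually_elim
      case (elim x)
      show ?case unfolding g_def
        by (intro filterlim_compose[OF ctmc_set_difference_quotient[OF C]
              filterlim_inverse_scaled[of 1]]) (use F[OF elim] in auto)
    qed
    show "AE x in measure_pmf p. norm (g n x) \<le> q" for n
      using S
    proof eventually_elim
      case (elim x)
      define t where "t = 1 / real (Suc n)"
      have t: "t > 0" by (simp add: t_def)
      have "\<bar>measure (measure_pmf (P t x)) A - indicator A x\<bar> \<le> - Q x x * t"
        using measure_pmf_indicator_diff_le[of "P t x" A x] ctmc_holding_probability[OF C elim t]
        by linarith
      also have "\<dots> \<le> q * t" using q[OF elim] t by (intro mult_right_mono) auto
      finally have "\<bar>measure (measure_pmf (P t x)) A - indicator A x\<bar> / t \<le> q"
        using t by (simp add: field_simps)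
      then show ?case using t unfolding g_def t_def[symmetric] by (simp add: abs_divide)
    qed
  qed auto
  moreover have "measure_pmf.expectation p (g n) = 0" for n
  proof -
    have "measure (measure_pmf p) A
        = (\<integral>x. measure (measure_pmf (P (1 / real (Suc n)) x)) A \<partial>measure_pmf p)"
      using st measure_bind_pmf[of p "P (1 / real (Suc n))" A]
      by (simp add: stationary_distribution_def)
    moreover have "integrable (measure_pmf p) (\<lambda>x. measure (measure_pmf (P (1 / real (Suc n)) x)) A)"
      by (intro measure_pmf.integrable_const_bound[where B=1]) auto
    moreover have "integrable (measure_pmf p) (indicat_real A)"
      by (intro measure_pmf.integrable_const_bound[where B=1]) (auto simp: indicator_def)
    ultimately show ?thesis by (simp add: g_def[abs_def] Bochner_Integration.integral_diff)
  qed
  ultimately show ?thesis by (simp add: LIMSEQ_const_iff)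
qed

section \<open>Balance equations of the queue\<close>

fun high_count :: "state \<Rightarrow> nat" where
  "high_count (Vacation j) = 0"
| "high_count (Working n j) = n"

fun low_count :: "state \<Rightarrow> nat" where
  "low_count (Vacation j) = j"
| "low_count (Working n j) = j"

fun serving_low :: "state \<Rightarrow> bool" where
  "serving_low (Vacation j) = False"
| "serving_low (Working n j) = (n = 0)"

text \<open>
  A finite set containing \<open>x\<close> and the targets of all events, so that the row of the rate matrix at \<open>x\<close>
  vanishes outside it.  The elements may coincide, which is why sums over it are evaluated through
  \<open>rate_matrix_sum_successors\<close>.
\<close>
definition successors :: "nat \<Rightarrow> state \<Rightarrow> state set" where
  "successors N x = {x, high_arrival x, low_arrival N x, departure x}"

lemma successors_subset_states: "N \<ge> 1 \<Longrightarrow> x \<in> states N \<Longrightarrow> successors N x \<subseteq> states N"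
  by (cases x) (auto simp: states_def successors_def)

lemma rate_matrix_sum_successors:
  "(\<Sum>y\<in>successors N x \<inter> A. rate_matrix lam1 lam2 mu1 mu2 N x y) =
     lam1 * (indicator A (high_arrival x) - indicator A x) +
     lam2 * (indicator A (low_arrival N x) - indicator A x) +
     service_rate mu1 mu2 x * (indicator A (departure x) - indicator A x)"
proof -
  have fin: "finite (successors N x \<inter> A)" by (simp add: successors_def)
  have "(\<Sum>y\<in>successors N x \<inter> A. of_bool (y = z)) = indicat_real A z" if "z \<in> successors N x" for z
    using fin that by (simp add: of_bool_def indicator_def)
  then show ?thesis
    by (simp add: rate_matrix_def sum.distrib sum_subtractf sum_distrib_left[symmetric])
      (simp add: successors_def)
qed

text \<open>
  The exponent 0 contributes \<open>0 ^ 0 = 1\<close>, so \<open>\<beta> 0\<close> is the normalising constant \<open>1 / H 1\<close> of the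
  truncated geometric law of the vacation states.
\<close>
lemma H_0: "N \<ge> 1 \<Longrightarrow> H lam1 lam2 N 0 = 1"
  by (cases N) (simp_all add: H_def lessThan_Suc_eq_insert_0 power_0_left)

lemma H_1_pos: "lam1 > 0 \<Longrightarrow> lam2 > 0 \<Longrightarrow> N \<ge> 1 \<Longrightarrow> H lam1 lam2 N 1 > 0"
  unfolding H_def by (intro sum_pos) (auto simp: lessThan_empty_iff)

locale stationary_queue =
  fixes lam1 lam2 mu1 mu2 :: real and N :: nat
    and P :: "real \<Rightarrow> state \<Rightarrow> state pmf" and p :: "state pmf"
  assumes lam1: "lam1 > 0" and lam2: "lam2 > 0" and mu1: "mu1 > 0" and mu2: "mu2 > 0"
    and N: "N \<ge> 1"
    and chain: "ctmc (states N) (rate_matrix lam1 lam2 mu1 mu2 N) P"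
    and stationary: "stationary_distribution (states N) P p"
begin

abbreviation prob :: "state set \<Rightarrow> real" where
  "prob A \<equiv> measure (measure_pmf p) A"

lemma set_pmf_subset: "set_pmf p \<subseteq> states N"
  using stationary by (simp add: stationary_distribution_def)

lemma prob_cong: "(\<And>x. x \<in> states N \<Longrightarrow> x \<in> A \<longleftrightarrow> x \<in> B) \<Longrightarrow> prob A = prob B"
  by (subst (1 2) measure_Int_set_pmf[symmetric], rule arg_cong[where f=prob])
    (use set_pmf_subset in auto)

text \<open>
  Each event contributes the rate at which it enters \<open>A\<close> minus the rate at which it occurs in \<open>A\<close>;
  jumps within \<open>A\<close> cancel.  The service term splits according to the class in service.
\<close>
lemma flow_balance:
  "lam1 * (prob {x. high_arrival x \<in> A} - prob A)
   + lam2 * (prob {x. low_arrival N x \<in> A} - prob A)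
   + mu1 * (prob {x. high_count x \<ge> 1 \<and> departure x \<in> A} - prob {x. high_count x \<ge> 1 \<and> x \<in> A})
   + mu2 * (prob {x. serving_low x \<and> departure x \<in> A} - prob {x. serving_low x \<and> x \<in> A}) = 0"
proof -
  have int: "integrable (measure_pmf p) (indicat_real B)" for B
    by (intro measure_pmf.integrable_const_bound[where B=1]) (auto simp: indicator_def)
  have "measure_pmf.expectation p
     (\<lambda>x. \<Sum>y\<in>successors N x \<inter> A. rate_matrix lam1 lam2 mu1 mu2 N x y) = 0"
  proof (rule stationary_flow_balance[OF chain stationary, where q="lam1 + lam2 + mu1 + mu2"])
    fix x assume x: "x \<in> states N"
    show "x \<in> successors N x \<and> finite (successors N x) \<and> successors N x \<subseteq> states N
        \<and> (\<Sum>y\<in>successors N x. rate_matrix lam1 lam2 mu1 mu2 N x y) = 0"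
      using successors_subset_states[OF N x]
        rate_matrix_sum_successors[of lam1 lam2 mu1 mu2 N x UNIV]
      by (simp add: successors_def)
    show "- rate_matrix lam1 lam2 mu1 mu2 N x x \<le> lam1 + lam2 + mu1 + mu2"
      using lam1 lam2 mu1 mu2 by (cases x) (auto simp: rate_matrix_def)
  qed
  also have "(\<lambda>x. \<Sum>y\<in>successors N x \<inter> A. rate_matrix lam1 lam2 mu1 mu2 N x y) =
    (\<lambda>x. lam1 * (indicator {x. high_arrival x \<in> A} x - indicator A x)
     + lam2 * (indicator {x. low_arrival N x \<in> A} x - indicator A x)
     + mu1 * (indicator {x. high_count x \<ge> 1 \<and> departure x \<in> A} x
          - indicator {x. high_count x \<ge> 1 \<and> x \<in> A} x)
     + mu2 * (indicator {x. serving_low x \<and> departure x \<in> A} x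
          - indicator {x. serving_low x \<and> x \<in> A} x))"
  proof
    fix x
    show "(\<Sum>y\<in>successors N x \<inter> A. rate_matrix lam1 lam2 mu1 mu2 N x y) =
      lam1 * (indicator {x. high_arrival x \<in> A} x - indicator A x)
     + lam2 * (indicator {x. low_arrival N x \<in> A} x - indicator A x)
     + mu1 * (indicator {x. high_count x \<ge> 1 \<and> departure x \<in> A} x
          - indicator {x. high_count x \<ge> 1 \<and> x \<in> A} x)
     + mu2 * (indicator {x. serving_low x \<and> departure x \<in> A} x
          - indicator {x. serving_low x \<and> x \<in> A} x)"
      unfolding rate_matrix_sum_successors by (cases x) (auto simp: indicator_def)
  qed
  finally show ?thesis
    by (simp only: Bochner_Integration.integral_add Bochner_Integration.integral_diff
        integral_mult_right_zero Bochner_Integration.integrable_add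
        Bochner_Integration.integrable_diff integrable_mult_right int
        integral_indicator sets_measure_pmf space_measure_pmf) simp
qed

section \<open>The probability of the empty system\<close>

text \<open>
  A vacation state with at least one waiting customer is entered only by a low-priority arrival,
  because the vacation always begins in the empty system.
\<close>
lemma vacation_balance:
  assumes "Suc k < N"
  shows "(lam1 + lam2) * pmf p (Vacation (Suc k)) = lam2 * pmf p (Vacation k)"
proof -
  let ?A = "{Vacation (Suc k)}"
  have [simp]: "high_arrival x \<noteq> Vacation (Suc k)" for x by (cases x) auto
  have dep: "departure x = Vacation (Suc k) \<longleftrightarrow> x = Vacation (Suc k)" for x by (cases x) auto
  have 1: "prob {x. high_arrival x \<in> ?A} = 0" by simp
  have 2: "prob {x. low_arrival N x \<in> ?A} = prob {Vacation k}"
  proof (rule prob_cong)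
    fix x show "x \<in> {x. low_arrival N x \<in> ?A} \<longleftrightarrow> x \<in> {Vacation k}"
      using assms by (cases x) auto
  qed
  have 3: "{x. high_count x \<ge> 1 \<and> departure x \<in> ?A} = {x. high_count x \<ge> 1 \<and> x \<in> ?A}"
      "{x. serving_low x \<and> departure x \<in> ?A} = {x. serving_low x \<and> x \<in> ?A}"
    by (auto simp: dep)
  show ?thesis using flow_balance[of ?A] unfolding 1 2 3 by (simp add: measure_pmf_single algebra_simps)
qed

lemma vacation_geometric:
  "k < N \<Longrightarrow> pmf p (Vacation k) = (lam2 / (lam1 + lam2)) ^ k * pmf p (Vacation 0)"
proof (induction k)
  case (Suc k)
  have "pmf p (Vacation (Suc k)) = lam2 / (lam1 + lam2) * pmf p (Vacation k)"
    using vacation_balance[OF Suc.prems] lam1 lam2 by (simp add: field_simps)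
  then show ?case using Suc by simp
qed simp

text \<open>
  The number of high-priority customers changes by steps of one, and low-priority customers have no
  influence on it: it crosses from \<open>k\<close> to \<open>k + 1\<close> and back equally often.
\<close>
lemma high_cut: "lam1 * prob {x. high_count x = k} = mu1 * prob {x. high_count x = Suc k}"
proof -
  let ?A = "{x. high_count x > k}"
  have 1: "prob {x. high_arrival x \<in> ?A} = prob ?A + prob {x. high_count x = k}"
  proof -
    have "{x. high_arrival x \<in> ?A} = ?A \<union> {x. high_count x = k}"
    proof (rule set_eqI)
      fix x show "x \<in> {x. high_arrival x \<in> ?A} \<longleftrightarrow> x \<in> ?A \<union> {x. high_count x = k}"
        by (cases x) auto
    qed
    then show ?thesis by (subst measure_pmf.finite_measure_Union[symmetric]) auto
  qed
  have 2: "{x. low_arrival N x \<in> ?A} = ?A"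
  proof (rule set_eqI)
    fix x show "x \<in> {x. low_arrival N x \<in> ?A} \<longleftrightarrow> x \<in> ?A" by (cases x) auto
  qed
  have 3: "prob {x. high_count x \<ge> 1 \<and> x \<in> ?A}
      = prob {x. high_count x \<ge> 1 \<and> departure x \<in> ?A} + prob {x. high_count x = Suc k}"
  proof -
    have "{x. high_count x \<ge> 1 \<and> x \<in> ?A}
        = {x. high_count x \<ge> 1 \<and> departure x \<in> ?A} \<union> {x. high_count x = Suc k}"
    proof (rule set_eqI)
      fix x show "x \<in> {x. high_count x \<ge> 1 \<and> x \<in> ?A} \<longleftrightarrow>
          x \<in> {x. high_count x \<ge> 1 \<and> departure x \<in> ?A} \<union> {x. high_count x = Suc k}"
        by (cases x) auto
    qed
    moreover have "{x. high_count x \<ge> 1 \<and> departure x \<in> ?A} \<inter> {x. high_count x = Suc k} = {}"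
    proof (rule equals0I)
      fix x assume "x \<in> {x. high_count x \<ge> 1 \<and> departure x \<in> ?A} \<inter> {x. high_count x = Suc k}"
      then show False by (cases x) (auto split: if_splits)
    qed
    ultimately show ?thesis by (simp add: measure_pmf.finite_measure_Union)
  qed
  have 4: "{x. serving_low x \<and> departure x \<in> ?A} = {x. serving_low x \<and> x \<in> ?A}"
  proof (rule set_eqI)
    fix x show "x \<in> {x. serving_low x \<and> departure x \<in> ?A} \<longleftrightarrow> x \<in> {x. serving_low x \<and> x \<in> ?A}"
      by (cases x) auto
  qed
  show ?thesis using flow_balance[of ?A] unfolding 1 2 3 4 by (simp add: algebra_simps)
qed

text \<open>
  The same crossing argument for low-priority customers, who arrive in every state but depart only when
  no high-priority customer is present and the server works.
\<close>
lemma low_cut: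
  "lam2 * prob {x. low_count x = k} = mu2 * prob {x. serving_low x \<and> low_count x = Suc k}"
proof -
  let ?A = "{x. low_count x > k}"
  have 1: "prob {x. low_arrival N x \<in> ?A} = prob ?A + prob {x. low_count x = k}"
  proof -
    have "{x. low_arrival N x \<in> ?A} = ?A \<union> {x. low_count x = k}"
    proof (rule set_eqI)
      fix x show "x \<in> {x. low_arrival N x \<in> ?A} \<longleftrightarrow> x \<in> ?A \<union> {x. low_count x = k}"
        by (cases x) auto
    qed
    then show ?thesis by (subst measure_pmf.finite_measure_Union[symmetric]) auto
  qed
  have 2: "{x. high_arrival x \<in> ?A} = ?A"
  proof (rule set_eqI)
    fix x show "x \<in> {x. high_arrival x \<in> ?A} \<longleftrightarrow> x \<in> ?A" by (cases x) auto
  qed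
  have 3: "prob {x. serving_low x \<and> x \<in> ?A}
      = prob {x. serving_low x \<and> departure x \<in> ?A} + prob {x. serving_low x \<and> low_count x = Suc k}"
  proof -
    have "{x. serving_low x \<and> x \<in> ?A}
        = {x. serving_low x \<and> departure x \<in> ?A} \<union> {x. serving_low x \<and> low_count x = Suc k}"
    proof (rule set_eqI)
      fix x show "x \<in> {x. serving_low x \<and> x \<in> ?A} \<longleftrightarrow>
          x \<in> {x. serving_low x \<and> departure x \<in> ?A} \<union> {x. serving_low x \<and> low_count x = Suc k}"
        by (cases x) auto
    qed
    moreover have "{x. serving_low x \<and> departure x \<in> ?A}
        \<inter> {x. serving_low x \<and> low_count x = Suc k} = {}"
    proof (rule equals0I)
      fix x assume "x \<in> {x. serving_low x \<and> departure x \<in> ?A}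
        \<inter> {x. serving_low x \<and> low_count x = Suc k}"
      then show False by (cases x) (auto split: if_splits)
    qed
    ultimately show ?thesis by (simp add: measure_pmf.finite_measure_Union)
  qed
  have 4: "{x. high_count x \<ge> 1 \<and> departure x \<in> ?A} = {x. high_count x \<ge> 1 \<and> x \<in> ?A}"
  proof (rule set_eqI)
    fix x show "x \<in> {x. high_count x \<ge> 1 \<and> departure x \<in> ?A} \<longleftrightarrow>
        x \<in> {x. high_count x \<ge> 1 \<and> x \<in> ?A}"
      by (cases x) auto
  qed
  show ?thesis using flow_balance[of ?A] unfolding 1 2 3 4 by (simp add: algebra_simps)
qed

lemma prob_sums: "(\<lambda>k::nat. prob {x. Q x \<and> f x = k}) sums prob {x. Q x}"
proof -
  have "(\<lambda>k. prob {x. Q x \<and> f x = k}) sums prob (\<Union>k. {x. Q x \<and> f x = k})"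
    by (intro measure_pmf.finite_measure_UNION) (auto simp: disjoint_family_on_def)
  moreover have "(\<Union>k. {x. Q x \<and> f x = k}) = {x. Q x}" by auto
  ultimately show ?thesis by simp
qed

text \<open>
  Summed over all levels \<open>k\<close>, a cut equation says that arrivals at rate \<open>a\<close> equal departures at rate \<open>b\<close>
  during the time in which the class is served (\<open>Q\<close>).  So the class is in service for a fraction
  \<open>a / b\<close> of the time.
\<close>
lemma cut_sum:
  assumes cut: "\<And>k. a * prob {x. f x = k} = b * prob {x. Q x \<and> f x = Suc k}"
    and zero: "prob {x. Q x \<and> f x = 0} = 0"
  shows "a = b * prob {x. Q x}"
proof -
  have "(\<lambda>k. prob {x. Q x \<and> f x = Suc k}) sums prob {x. Q x}"
    using prob_sums[of Q f] zero by (subst sums_Suc_iff) simp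
  then have "(\<lambda>k. b * prob {x. Q x \<and> f x = Suc k}) sums (b * prob {x. Q x})"
    by (rule sums_mult)
  moreover have "(\<lambda>k. a * prob {x. f x = k}) sums (a * prob UNIV)"
    using prob_sums[of "\<lambda>_. True" f] by (intro sums_mult) simp
  ultimately show ?thesis by (simp add: cut sums_unique2)
qed

lemma prob_serving_high: "prob {x. high_count x \<ge> 1} = lam1 / mu1"
proof -
  have "lam1 = mu1 * prob {x. high_count x \<ge> 1}"
  proof (rule cut_sum)
    show "lam1 * prob {x. high_count x = k} = mu1 * prob {x. high_count x \<ge> 1 \<and> high_count x = Suc k}" for k
      unfolding high_cut by (auto intro!: arg_cong[where f=prob])
    have "{x. high_count x \<ge> 1 \<and> high_count x = 0} = {}" by auto
    then show "prob {x. high_count x \<ge> 1 \<and> high_count x = 0} = 0" by (simp only: measure_empty)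
  qed
  then show ?thesis using mu1 by (simp add: field_simps)
qed

lemma prob_serving_low: "prob {x. serving_low x} = lam2 / mu2"
proof -
  have "lam2 = mu2 * prob {x. serving_low x}"
  proof (rule cut_sum[OF low_cut])
    \<comment> \<open>\<open>Working 0 0\<close> is not a state of the chain: an empty system means vacation.\<close>
    have "prob {x. serving_low x \<and> low_count x = 0} = prob {}"
    proof (rule prob_cong)
      fix x assume "x \<in> states N"
      then show "x \<in> {x. serving_low x \<and> low_count x = 0} \<longleftrightarrow> x \<in> {}"
        by (cases x) (auto simp: states_def)
    qed
    then show "prob {x. serving_low x \<and> low_count x = 0} = 0" by simp
  qed
  then show ?thesis using mu2 by (simp add: field_simps)
qed

text \<open>
  In the states that the chain can visit, being on vacation is the complement of serving a
  high-priority or a low-priority customer, and these two events are disjoint.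
\<close>
lemma prob_vacation: "prob (Vacation ` {..<N}) = 1 - lam1 / mu1 - lam2 / mu2"
proof -
  let ?B = "{x. high_count x \<ge> 1} \<union> {x. serving_low x}"
  have "prob ?B = lam1 / mu1 + lam2 / mu2"
  proof -
    have "high_count x = 0" if "serving_low x" for x using that by (cases x) auto
    then show ?thesis
      by (subst measure_pmf.finite_measure_Union) (auto simp: prob_serving_high[simplified] prob_serving_low)
  qed
  moreover have "prob (Vacation ` {..<N}) = prob (- ?B)"
  proof (rule prob_cong)
    fix x assume "x \<in> states N"
    then show "x \<in> Vacation ` {..<N} \<longleftrightarrow> x \<in> - ?B"
      by (cases x) (auto simp: states_def)
  qed
  moreover have "prob (- ?B) = 1 - prob ?B"
    using measure_pmf.prob_compl[of ?B p] by (simp add: Compl_eq_Diff_UNIV)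
  ultimately show ?thesis by simp
qed

lemma vacation_0:
  "pmf p (Vacation 0) = \<beta> lam1 lam2 N 0 * (1 - lam1 / mu1 - lam2 / mu2)"
proof -
  have "1 - lam1 / mu1 - lam2 / mu2 = (\<Sum>x\<in>Vacation ` {..<N}. pmf p x)"
    unfolding prob_vacation[symmetric] by (simp add: measure_measure_pmf_finite)
  also have "\<dots> = (\<Sum>k<N. pmf p (Vacation k))"
    by (subst sum.reindex) (auto simp: inj_on_def)
  also have "\<dots> = (\<Sum>k<N. (lam2 / (lam1 + lam2)) ^ k * pmf p (Vacation 0))"
    by (intro sum.cong refl vacation_geometric) simp
  also have "\<dots> = H lam1 lam2 N 1 * pmf p (Vacation 0)"
    by (simp add: H_def sum_distrib_right)
  finally have "1 - lam1 / mu1 - lam2 / mu2 = H lam1 lam2 N 1 * pmf p (Vacation 0)" .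
  then show ?thesis using H_0[OF N] H_1_pos[OF lam1 lam2 N] by (simp add: \<beta>_def)
qed

section \<open>Levels with a fixed number of low-priority customers\<close>

text \<open>
  For \<open>n \<ge> 1\<close> this is the probability of \<open>Working n j\<close>.  For \<open>n = 0\<close> the vacation state and the
  working state with \<open>j\<close> low-priority customers are taken together: a high-priority arrival
  leads from both to \<open>Working 1 j\<close>, so the recurrence in \<open>n\<close> has the same form from the start.
\<close>
definition level_prob :: "nat \<Rightarrow> nat \<Rightarrow> real" where
  "level_prob j n = prob {x. high_count x = n \<and> low_count x = j}"

lemma level_prob_Suc: "level_prob j (Suc n) = pmf p (Working (Suc n) j)"
proof -
  have "{x. high_count x = Suc n \<and> low_count x = j} = {Working (Suc n) j}"
  proof (rule set_eqI)
    fix x show "x \<in> {x. high_count x = Suc n \<and> low_count x = j} \<longleftrightarrow> x \<in> {Working (Suc n) j}"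
      by (cases x) auto
  qed
  then show ?thesis by (simp add: level_prob_def measure_pmf_single)
qed

lemma level_prob_0: "level_prob 0 0 = pmf p (Vacation 0)"
proof -
  have "level_prob 0 0 = prob {Vacation 0}" unfolding level_prob_def
  proof (rule prob_cong)
    fix x assume "x \<in> states N"
    then show "x \<in> {x. high_count x = 0 \<and> low_count x = 0} \<longleftrightarrow> x \<in> {Vacation 0}"
      by (cases x) (auto simp: states_def)
  qed
  then show ?thesis by (simp add: measure_pmf_single)
qed

lemma level_balance:
  "(lam1 + lam2 + mu1) * level_prob j (Suc n) = lam1 * level_prob j n
     + lam2 * (if j = 0 then 0 else level_prob (j - 1) (Suc n)) + mu1 * level_prob j (Suc (Suc n))"
proof -
  let ?L = "\<lambda>j n. {x. high_count x = n \<and> low_count x = j}"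
  let ?A = "?L j (Suc n)"
  have 1: "{x. high_arrival x \<in> ?A} = ?L j n"
  proof (rule set_eqI)
    fix x show "x \<in> {x. high_arrival x \<in> ?A} \<longleftrightarrow> x \<in> ?L j n" by (cases x) auto
  qed
  have 2: "{x. low_arrival N x \<in> ?A} = (if j = 0 then {} else ?L (j - 1) (Suc n))"
  proof (rule set_eqI)
    fix x show "x \<in> {x. low_arrival N x \<in> ?A} \<longleftrightarrow> x \<in> (if j = 0 then {} else ?L (j - 1) (Suc n))"
      by (cases x) auto
  qed
  have 3: "{x. high_count x \<ge> 1 \<and> departure x \<in> ?A} = ?L j (Suc (Suc n))"
  proof (rule set_eqI)
    fix x show "x \<in> {x. high_count x \<ge> 1 \<and> departure x \<in> ?A} \<longleftrightarrow> x \<in> ?L j (Suc (Suc n))"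
      by (cases x) auto
  qed
  have 4: "{x. high_count x \<ge> 1 \<and> x \<in> ?A} = ?A" by auto
  have 5: "{x. serving_low x \<and> departure x \<in> ?A} = {}" "{x. serving_low x \<and> x \<in> ?A} = {}"
  proof -
    have "serving_low x \<Longrightarrow> departure x \<notin> ?A \<and> x \<notin> ?A" for x by (cases x) auto
    then show "{x. serving_low x \<and> departure x \<in> ?A} = {}" "{x. serving_low x \<and> x \<in> ?A} = {}" by blast+
  qed
  show ?thesis using flow_balance[of ?A] unfolding 1 2 3 4 5
    by (auto simp: level_prob_def algebra_simps)
qed

text \<open>
  The characteristic equation of \<open>level_balance\<close> in \<open>n\<close> is
  \<open>mu1 * X\<^sup>2 - (lam1 + lam2 + mu1) * X + lam1 = 0\<close>.  Its smaller root is \<open>c0\<close>; its value at 1 is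
  \<open>- lam2 < 0\<close>, so the larger root exceeds 1.
\<close>
definition discr :: real where
  "discr = (lam1 + lam2 + mu1)\<^sup>2 - 4 * lam1 * mu1"

definition small_root :: real where
  "small_root = c0 lam1 lam2 mu1"

definition large_root :: real where
  "large_root = (lam1 + lam2 + mu1 + sqrt discr) / (2 * mu1)"

lemma discr_gt: "(lam1 + lam2 - mu1)\<^sup>2 < discr" "(mu1 - lam1 - lam2)\<^sup>2 < discr" "discr > 0"
proof -
  have "discr = (lam1 + lam2 - mu1)\<^sup>2 + 4 * lam2 * mu1"
    by (simp add: discr_def power2_eq_square algebra_simps)
  then show 1: "(lam1 + lam2 - mu1)\<^sup>2 < discr" using lam2 mu1 by simp
  then show "(mu1 - lam1 - lam2)\<^sup>2 < discr" by (simp add: power2_eq_square algebra_simps)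
  show "discr > 0" using 1 zero_le_power2[of "lam1 + lam2 - mu1"] by linarith
qed

lemma root_sum: "mu1 * (small_root + large_root) = lam1 + lam2 + mu1"
  using mu1 by (simp add: small_root_def large_root_def c0_def discr_def field_simps)

lemma root_diff: "mu1 * (large_root - small_root) = sqrt discr"
  using mu1 by (simp add: small_root_def large_root_def c0_def discr_def field_simps)

lemma root_prod: "mu1 * (small_root * large_root) = lam1"
proof -
  have "4 * mu1 * (mu1 * (small_root * large_root))
      = (mu1 * (small_root + large_root))\<^sup>2 - (mu1 * (large_root - small_root))\<^sup>2"
    by (simp add: power2_eq_square algebra_simps)
  also have "\<dots> = (lam1 + lam2 + mu1)\<^sup>2 - discr"
    unfolding root_sum root_diff using discr_gt(3) by simp
  also have "\<dots> = 4 * mu1 * lam1" by (simp add: discr_def)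
  finally show ?thesis using mu1 by simp
qed

lemma roots: "0 < small_root" "small_root < large_root" "1 < large_root"
proof -
  have "\<bar>mu1 - lam1 - lam2\<bar> < sqrt discr"
    using discr_gt(2) by (metis real_sqrt_abs real_sqrt_less_mono)
  then show large: "1 < large_root" using mu1 by (simp add: large_root_def field_simps)
  have "0 < small_root * large_root" using root_prod lam1 mu1 by (metis zero_less_mult_pos)
  then show "0 < small_root" using large by (simp add: zero_less_mult_iff)
  have "0 < mu1 * (large_root - small_root)" unfolding root_diff using discr_gt(3) by simp
  then show "small_root < large_root" using mu1 by (simp add: zero_less_mult_iff)
qed

text \<open>
  The recurrence in \<open>n\<close> factors through its two roots.  The defect from being geometric with
  ratio \<open>small_root\<close> satisfies a first-order recurrence with the multiplier \<open>large_root\<close>.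
\<close>
definition defect :: "nat \<Rightarrow> nat \<Rightarrow> real" where
  "defect j n = level_prob j (Suc n) - small_root * level_prob j n"

lemma defect_Suc:
  "defect j (Suc n) = large_root * defect j n
     - lam2 / mu1 * (if j = 0 then 0 else level_prob (j - 1) (Suc n))"
proof -
  have "mu1 * defect j (Suc n) = mu1 * (large_root * defect j n)
     - lam2 * (if j = 0 then 0 else level_prob (j - 1) (Suc n))"
    using level_balance[of j n] unfolding root_sum[symmetric]
    by (subst (asm) root_prod[symmetric]) (simp add: defect_def algebra_simps)
  then have "defect j (Suc n) = (mu1 * (large_root * defect j n)
     - lam2 * (if j = 0 then 0 else level_prob (j - 1) (Suc n))) / mu1"
    using mu1 by (simp add: nonzero_eq_divide_eq mult.commute)
  then show ?thesis using mu1 by (simp add: diff_divide_distrib)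
qed

lemma defect_bounded: "Bseq (defect j)"
proof (rule BseqI'[of _ "1 + small_root"])
  fix n
  have "0 \<le> level_prob j n" "level_prob j n \<le> 1" for n by (auto simp: level_prob_def)
  then have "\<bar>level_prob j (Suc n)\<bar> \<le> 1" "\<bar>small_root * level_prob j n\<bar> \<le> small_root * 1"
    using roots(1) by (auto simp: abs_mult intro!: mult_left_mono)
  then show "norm (defect j n) \<le> 1 + small_root" by (simp add: defect_def)
qed

text \<open>
  Without a source term, a nonzero defect would grow like \<open>large_root ^ n\<close>, which is impossible for
  probabilities.
\<close>
lemma level_0_geometric: "level_prob 0 n = small_root ^ n * pmf p (Vacation 0)"
proof -
  have pow: "defect 0 n = large_root ^ n * defect 0 0" for n
    by (induction n) (simp_all add: defect_Suc)
  obtain K where K: "\<And>n. norm (defect 0 n) \<le> K" using defect_bounded[of 0] by (auto simp: Bseq_def)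
  have "defect 0 0 = 0"
  proof (rule ccontr)
    assume nz: "defect 0 0 \<noteq> 0"
    obtain n where "K / \<bar>defect 0 0\<bar> < large_root ^ n"
      using real_arch_pow[OF roots(3)] by blast
    then have "K < norm (defect 0 n)"
      using nz by (simp add: pow[of n] abs_mult power_abs field_simps)
        (use roots(3) in \<open>simp add: mult.commute\<close>)
    then show False using K[of n] by simp
  qed
  then have "defect 0 n = 0" for n using pow[of n] by simp
  then have "level_prob 0 (Suc n) = small_root * level_prob 0 n" for n by (simp add: defect_def)
  then show ?thesis by (induction n) (simp_all add: level_prob_0)
qed

text \<open>
  Level \<open>j\<close> acts as a source for level \<open>j + 1\<close>.  The defect of level \<open>j + 1\<close> is of the order of that
  source, and removing the remaining factor resonates with it, which adds a power of \<open>n\<close>.  The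
  constants combine by \<open>mu1 * (large_root - small_root) = sqrt discr\<close>.
\<close>
lemma level_asymptotics:
  "(\<lambda>n. level_prob j n / (real n ^ j * small_root ^ n))
     \<longlonglongrightarrow> pmf p (Vacation 0) * (lam2 / sqrt discr) ^ j / fact j"
proof (induction j)
  case 0
  then show ?case using roots(1) by (simp add: level_0_geometric)
next
  case (Suc j)
  define B where "B = pmf p (Vacation 0) * (lam2 / sqrt discr) ^ j / fact j"
  have "(\<lambda>n. defect (Suc j) n / (real n ^ j * small_root ^ n))
      \<longlonglongrightarrow> lam2 / mu1 * B * small_root / (large_root - small_root)"
    by (rule growing_recurrence_bounded_solution[OF _ defect_bounded roots Suc[folded B_def]])
      (simp add: defect_Suc)
  then have "(\<lambda>n. level_prob (Suc j) n / (real n ^ Suc j * small_root ^ n)) \<longlonglongrightarrow>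
      lam2 / mu1 * B * small_root / (large_root - small_root) / (small_root * real (Suc j))"
    by (intro resonant_recurrence_asymptotics[OF _ roots(1)]) (auto simp: defect_def)
  also have "lam2 / mu1 * B * small_root / (large_root - small_root) / (small_root * real (Suc j))
      = lam2 * B / (mu1 * (large_root - small_root) * real (Suc j))"
    using roots(1) by simp
  also have "\<dots> = pmf p (Vacation 0) * (lam2 / sqrt discr) ^ Suc j / fact (Suc j)"
    by (simp add: root_diff B_def field_simps)
  finally show ?case .
qed

end

theorem theorem3:
  fixes lam1 lam2 mu1 mu2 :: real and N j :: nat
    and P :: "real \<Rightarrow> state \<Rightarrow> state pmf" and p :: "state pmf"
  assumes "lam1 > 0" and "lam2 > 0" and "mu1 > 0" and "mu2 > 0" and "N \<ge> 1"
    and "lam1 / mu1 + lam2 / mu2 < 1"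
    and "ctmc (states N) (rate_matrix lam1 lam2 mu1 mu2 N) P"
    and "stationary_distribution (states N) P p"
  shows "(\<lambda>n. pmf p (Working n j) /
           (\<beta> lam1 lam2 N 0 * (1 - lam1 / mu1 - lam2 / mu2) * (c1 lam1 lam2 mu1 ^ j / fact j)
             * real n ^ j * c0 lam1 lam2 mu1 powi (int n - int j)))
         \<longlonglongrightarrow> 1"
proof -
  interpret stationary_queue lam1 lam2 mu1 mu2 N P p
    by unfold_locales (use assms in auto)
  define D where "D = pmf p (Vacation 0) * (lam2 / sqrt discr) ^ j / fact j"
  have "\<beta> lam1 lam2 N 0 > 0" using H_0[OF N] H_1_pos[OF lam1 lam2 N] by (simp add: \<beta>_def)
  then have "pmf p (Vacation 0) > 0" using assms(6) by (simp add: vacation_0)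
  then have D: "D \<noteq> 0" using lam2 discr_gt(3) by (simp add: D_def)
  have "(\<lambda>n. level_prob j n / (real n ^ j * small_root ^ n) / D) \<longlonglongrightarrow> D / D"
    using level_asymptotics[of j] by (intro tendsto_divide tendsto_const D) (simp add: D_def)
  then have "(\<lambda>n. level_prob j n / (real n ^ j * small_root ^ n) / D) \<longlonglongrightarrow> 1"
    using D by simp
  moreover have "eventually (\<lambda>n. level_prob j n / (real n ^ j * small_root ^ n) / D
      = pmf p (Working n j) /
           (\<beta> lam1 lam2 N 0 * (1 - lam1 / mu1 - lam2 / mu2) * (c1 lam1 lam2 mu1 ^ j / fact j)
             * real n ^ j * c0 lam1 lam2 mu1 powi (int n - int j))) sequentially"
    using eventually_gt_at_top[of 0]
  proof eventually_elim
    case (elim n)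
    have "level_prob j n = pmf p (Working n j)"
      using elim level_prob_Suc[of j "n - 1"] by simp
    moreover have c1: "c1 lam1 lam2 mu1 ^ j = (lam2 / sqrt discr) ^ j * small_root ^ j"
      unfolding power_mult_distrib[symmetric] by (simp add: c1_def discr_def small_root_def)
    moreover have c0: "c0 lam1 lam2 mu1 powi (int n - int j) = small_root ^ n / small_root ^ j"
      using roots(1) by (simp add: small_root_def power_int_diff)
    have "\<beta> lam1 lam2 N 0 * (1 - lam1 / mu1 - lam2 / mu2) * (c1 lam1 lam2 mu1 ^ j / fact j)
        * real n ^ j * c0 lam1 lam2 mu1 powi (int n - int j) = real n ^ j * small_root ^ n * D"
      unfolding vacation_0[symmetric] c0 c1 D_def using roots(1) by simp
    ultimately show ?case by simp
  qed
  ultimately show ?thesis by (rule Lim_transform_eventually)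
qed

end
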